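(* Let $G_1,\ldots,G_k$ be a collection of graphs, all on the same vertex set $V$, and let $r_1,\ldots,r_k\in\mathbb{N}$. Then there exists an ordering $\sigma^*$ of the common vertex set $V$ such that for all $i=1,\ldots,k$, \[\operatorname{scol}_{r_i}(G_i,\sigma^* )\le(k+1)\bigl(\operatorname{wcol}_{2r_i}(G_i)\bigr)^2\le(k+1)\bigl(\operatorname{scol}_{2r_i}(G_i)\bigr)^{4r_i}.\]
   Context: All graphs $G=(V,E)$ are finite, simple and undirected. $\mathbb{N}$ denotes the positive integers. An ordering $\sigma$ of $G$ is a total ordering $<_\sigma$ of its vertex set $V$; $\Pi(G)$ denotes the set of all orderings of $G$. Let $r\in\mathbb{N}$, $\sigma\in\Pi(G)$ and $x\in V$. A vertex $y$ is weakly $r$-reachable from $x$ with respect to $\sigma$ if $y\le_\sigma x$ and there is a path $P$ in $G$ from $x$ to $y$ with at most $r$ edges such that every vertex $p\in V(P)$ satisfies $p\ge_\sigma y$; $y$ is strongly $r$-reachable from $x$ if $y\le_\sigma x$ and there is such a path $P$ with at most $r$ edges for which every $p\in V(P)\setminus\{y\}$ satisfies the stronger condition $p\ge_\sigma x$. Let $W_r[G,\sigma,x]$ and $S_r[G,\sigma,x]$ be the sets of vertices weakly, respectively strongly, $r$-reachable from $x$ (both contain $x$). Define $\operatorname{wcol}_r(G,\sigma)=\max_{x\in V}|W_r[G,\sigma,x]|$, $\operatorname{wcol}_r(G)=\min_{\sigma\in\Pi(G)}\operatorname{wcol}_r(G,\sigma)$, $\operatorname{scol}_r(G,\sigma)=\max_{x\in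 V}|S_r[G,\sigma,x]|$ and $\operatorname{scol}_r(G)=\min_{\sigma\in\Pi(G)}\operatorname{scol}_r(G,\sigma)$. *)

theory Defs
  imports
    "Graph_Theory.Pair_Digraph"
    "Graph_Theory.Vertex_Walk"
begin

text \<open>
  A finite simple undirected graph is a \<^locale>\<open>pair_graph\<close>: a finite loop-free symmetric digraph
  whose arcs are pairs of vertices. An ordering of its vertex set is the relation of a (reflexive)
  linear order; \<open>(a, b) \<in> \<sigma>\<close> means that \<open>a\<close> is at most \<open>b\<close>.
\<close>

definition orderings :: "'a pair_pre_digraph \<Rightarrow> 'a rel set" where
  "orderings G = {\<sigma>. linear_order_on (pverts G) \<sigma>}"

text \<open>A path may consist of a single vertex, so every vertex reaches itself.\<close>

definition path_between :: "'a pair_pre_digraph \<Rightarrow> 'a \<Rightarrow> 'a vwalk \<Rightarrow> 'a \<Rightarrow> bool" where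
  "path_between G x P y \<longleftrightarrow> vpath P (with_proj G) \<and> hd P = x \<and> last P = y"

definition weakly_reachable ::
  "nat \<Rightarrow> 'a pair_pre_digraph \<Rightarrow> 'a rel \<Rightarrow> 'a \<Rightarrow> 'a set" where
  "weakly_reachable r G \<sigma> x =
     {y. (y, x) \<in> \<sigma> \<and>
         (\<exists>P. path_between G x P y \<and> vwalk_length P \<le> r \<and> (\<forall>p\<in>set P. (y, p) \<in> \<sigma>))}"

definition strongly_reachable ::
  "nat \<Rightarrow> 'a pair_pre_digraph \<Rightarrow> 'a rel \<Rightarrow> 'a \<Rightarrow> 'a set" where
  "strongly_reachable r G \<sigma> x =
     {y. (y, x) \<in> \<sigma> \<and>
         (\<exists>P. path_between G x P y \<and> vwalk_length P \<le> r \<and> (\<forall>p\<in>set P - {y}. (x, p) \<in> \<sigma>))}"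

text \<open>
  On \<^typ>\<open>nat\<close> the supremum of a finite nonempty set is its maximum, and that of the empty set is 0.
  So the numbers below are maxima over the vertices, and 0 for the graph without vertices. The set
  of orderings of a finite graph is finite and nonempty, so the minima are proper.
\<close>

definition wcol_ord :: "nat \<Rightarrow> 'a pair_pre_digraph \<Rightarrow> 'a rel \<Rightarrow> nat" where
  "wcol_ord r G \<sigma> = (SUP x\<in>pverts G. card (weakly_reachable r G \<sigma> x))"

definition wcol :: "nat \<Rightarrow> 'a pair_pre_digraph \<Rightarrow> nat" where
  "wcol r G = (MIN \<sigma>\<in>orderings G. wcol_ord r G \<sigma>)"

definition scol_ord :: "nat \<Rightarrow> 'a pair_pre_digraph \<Rightarrow> 'a rel \<Rightarrow> nat" where
  "scol_ord r G \<sigma> = (SUP x\<in>pverts G. card (strongly_reachable r G \<sigma> x))"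

definition scol :: "nat \<Rightarrow> 'a pair_pre_digraph \<Rightarrow> nat" where
  "scol r G = (MIN \<sigma>\<in>orderings G. scol_ord r G \<sigma>)"

end

theory Submission
  imports Defs
begin

text \<open>
  For each \<open>i\<close>, fix an ordering \<open>\<tau>\<^sub>i\<close> that attains \<open>w\<^sub>i = wcol (2 * r\<^sub>i) G\<^sub>i\<close>, and let \<open>W\<^sub>i x\<close> be the
  vertices weakly reachable from \<open>x\<close> under \<open>\<tau>\<^sub>i\<close>. Build \<open>\<sigma>\<close> from its greatest element downwards:
  among the set \<open>U\<close> of vertices not yet placed, the average over \<open>z\<close> of the number of \<open>v \<in> U\<close> with
  \<open>z \<in> W\<^sub>i v\<close> is at most \<open>w\<^sub>i\<close>, so by Markov's inequality and a union bound some \<open>z\<close> has at most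
  \<open>k * w\<^sub>i\<close> such \<open>v\<close> for every \<open>i\<close> at once; place that \<open>z\<close>. Now let a path \<open>P\<close> witness that \<open>y\<close> is
  strongly reachable from \<open>x\<close> under \<open>\<sigma>\<close>, and let \<open>z\<close> be the \<open>\<tau>\<^sub>i\<close>-least vertex of \<open>P\<close>, so that
  \<open>z \<in> W\<^sub>i x \<inter> W\<^sub>i y\<close>. Either \<open>y = z\<close> lies in \<open>W\<^sub>i x\<close>, or \<open>y\<close> was unplaced when \<open>z\<close> was placed and
  is thus one of at most \<open>k * w\<^sub>i\<close> vertices. This gives at most \<open>w\<^sub>i + w\<^sub>i * (k * w\<^sub>i)\<close> choices of \<open>y\<close>.

  The second inequality holds as a weakly reachable vertex is reached by iterating strong
  reachability, cutting the path each time it drops below its current starting vertex.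
\<close>

section \<open>Greedy linear orders\<close>

lemma sum_card_swap:
  assumes "finite A" "finite B"
  shows "(\<Sum>x\<in>A. card {v\<in>B. R x v}) = (\<Sum>v\<in>B. card {x\<in>A. R x v})"
  using sum.swap_restrict[OF assms, of "\<lambda>_ _. 1::nat" R] by simp

text \<open>Markov's inequality with a union bound: counting the pairs \<open>(x, v)\<close> with
  \<open>x \<in> W i v\<close> from both sides shows that each index spoils fewer than a
  \<open>1 / card I\<close> share of \<open>U\<close>, so the spoiled sets cannot cover
  \<open>U\<close>.\<close>

lemma ex_small_preimages:
  fixes W :: "'i \<Rightarrow> 'a \<Rightarrow> 'a set"
  assumes fin: "finite U" "finite I" and ne: "U \<noteq> {}"
    and W: "\<And>i v. i \<in> I \<Longrightarrow> v \<in> U \<Longrightarrow> card (W i v \<inter> U) \<le> w i"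
  shows "\<exists>x\<in>U. \<forall>i\<in>I. card {v\<in>U. x \<in> W i v} \<le> card I * w i"
proof (rule ccontr)
  assume contra: "\<not> ?thesis"
  define B where "B i = {x\<in>U. card {v\<in>U. x \<in> W i v} > card I * w i}" for i
  have finB: "finite (B i)" for i
    using fin by (simp add: B_def)
  have small: "card I * card (B i) < card U" if i: "i \<in> I" for i
  proof -
    \<comment> \<open>Exceeding the threshold means reaching \<open>Suc (card I * w i)\<close>. The
      \<open>Suc\<close> leaves a summand \<open>card (B i)\<close>, which makes
      \<open>small\<close> strict even when \<open>w i = 0\<close>.\<close>
    have "card (B i) * Suc (card I * w i) \<le> (\<Sum>x\<in>B i. card {v\<in>U. x \<in> W i v})"
      using sum_bounded_below[of "B i" "Suc (card I * w i)" "\<lambda>x. card {v\<in>U. x \<in> W i v}"]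
      by (auto simp: B_def Suc_le_eq)
    also have "\<dots> = (\<Sum>v\<in>U. card {x\<in>B i. x \<in> W i v})"
      by (rule sum_card_swap[OF finB fin(1)])
    also have "\<dots> \<le> (\<Sum>v\<in>U. w i)"
    proof (rule sum_mono)
      fix v assume v: "v \<in> U"
      have "card {x\<in>B i. x \<in> W i v} \<le> card (W i v \<inter> U)"
        using fin by (intro card_mono) (auto simp: B_def)
      then show "card {x\<in>B i. x \<in> W i v} \<le> w i"
        using W[OF i v] by simp
    qed
    finally have le: "w i * (card I * card (B i)) + card (B i) \<le> w i * card U"
      by (simp add: algebra_simps)
    show ?thesis
    proof (rule ccontr)
      assume "\<not> ?thesis"
      then have ge: "card U \<le> card I * card (B i)" by simp
      then have "w i * card U \<le> w i * (card I * card (B i))" by simp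
      then have "card (B i) = 0" using le by linarith
      with ge have "card U = 0" by simp
      then show False using fin ne by simp
    qed
  qed
  have cover: "U \<subseteq> (\<Union>i\<in>I. B i)"
    using contra by (auto simp: B_def not_le)
  then have "I \<noteq> {}" using ne by auto
  have "card U \<le> card (\<Union>i\<in>I. B i)"
    using cover fin finB by (intro card_mono) auto
  also have "\<dots> \<le> (\<Sum>i\<in>I. card (B i))"
    by (rule card_UN_le[OF fin(2)])
  finally have "card I * card U \<le> (\<Sum>i\<in>I. card I * card (B i))"
    by (simp add: sum_distrib_left[symmetric])
  also have "\<dots> < (\<Sum>i\<in>I. card U)"
    using fin \<open>I \<noteq> {}\<close> small by (intro sum_strict_mono) auto
  finally show False by simp
qed

lemma linear_order_on_insert_top:
  assumes "linear_order_on A \<sigma>" "x \<notin> A"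
  shows "linear_order_on (insert x A) (\<sigma> \<union> insert x A \<times> {x})"
proof -
  let ?\<tau> = "\<sigma> \<union> insert x A \<times> {x}"
  have lin: "\<sigma> \<subseteq> A \<times> A" "\<forall>a\<in>A. (a, a) \<in> \<sigma>" "trans \<sigma>" "antisym \<sigma>" "total_on A \<sigma>"
    using assms(1) by (auto simp: order_on_defs refl_on_def)
  have "trans ?\<tau>"
  proof (rule transI)
    fix a b c assume "(a, b) \<in> ?\<tau>" "(b, c) \<in> ?\<tau>"
    then show "(a, c) \<in> ?\<tau>"
      using lin(1) assms(2) transD[OF lin(3), of a b c] by auto
  qed
  moreover have "antisym ?\<tau>"
  proof (rule antisymI)
    fix a b assume "(a, b) \<in> ?\<tau>" "(b, a) \<in> ?\<tau>"
    then show "a = b"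
      using lin(1) assms(2) antisymD[OF lin(4), of a b] by auto
  qed
  moreover have "total_on (insert x A) ?\<tau>"
    using lin(5) by (auto simp: total_on_def)
  moreover have "?\<tau> \<subseteq> insert x A \<times> insert x A" "refl_on (insert x A) ?\<tau>"
    using lin(1,2) by (auto simp: refl_on_def)
  ultimately show ?thesis
    by (simp add: order_on_defs)
qed

text \<open>Induction on \<open>card U\<close>: put the element given by
  \<open>ex_small_preimages\<close> on top of an order of the rest. The elements below
  \<open>z\<close> are exactly those unplaced when \<open>z\<close> is chosen, \<open>z\<close>
  included.\<close>

lemma ex_linear_order_small_preimages:
  fixes W :: "'i \<Rightarrow> 'a \<Rightarrow> 'a set"
  assumes "finite U" "finite I"
    and "\<And>i v. i \<in> I \<Longrightarrow> v \<in> U \<Longrightarrow> finite (W i v) \<and> card (W i v) \<le> w i"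
  shows "\<exists>\<sigma>. linear_order_on U \<sigma> \<and>
    (\<forall>z\<in>U. \<forall>i\<in>I. card {v. (v, z) \<in> \<sigma> \<and> z \<in> W i v} \<le> card I * w i)"
  using assms(1,3)
proof (induction "card U" arbitrary: U)
  case 0
  then show ?case by (intro exI[of _ "{}"]) simp
next
  case (Suc n)
  have "card (W i v \<inter> U) \<le> w i" if "i \<in> I" "v \<in> U" for i v
    using Suc.prems(2)[OF that] card_mono[of "W i v" "W i v \<inter> U"] by fastforce
  moreover have "U \<noteq> {}" using Suc.hyps(2) by auto
  ultimately obtain x where x: "x \<in> U"
    and light: "\<And>i. i \<in> I \<Longrightarrow> card {v\<in>U. x \<in> W i v} \<le> card I * w i"
    using ex_small_preimages[OF Suc.prems(1) assms(2)] by metis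
  let ?A = "U - {x}"
  have "n = card ?A" using Suc.hyps(2) Suc.prems(1) x by simp
  then obtain \<sigma> where lin: "linear_order_on ?A \<sigma>"
    and \<sigma>: "\<And>z i. z \<in> ?A \<Longrightarrow> i \<in> I \<Longrightarrow> card {v. (v, z) \<in> \<sigma> \<and> z \<in> W i v} \<le> card I * w i"
    using Suc.hyps(1)[of ?A] Suc.prems by auto
  have sub: "\<sigma> \<subseteq> ?A \<times> ?A"
    using lin unfolding order_on_defs by blast
  let ?\<sigma> = "\<sigma> \<union> U \<times> {x}"
  have "linear_order_on U ?\<sigma>"
    using linear_order_on_insert_top[OF lin, of x] unfolding insert_Diff[OF x] by simp
  moreover have "card {v. (v, z) \<in> ?\<sigma> \<and> z \<in> W i v} \<le> card I * w i"
    if "z \<in> U" "i \<in> I" for z i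
  proof (cases "z = x")
    case True
    have "{v. (v, x) \<in> ?\<sigma> \<and> x \<in> W i v} = {v\<in>U. x \<in> W i v}"
      using sub x by auto
    then show ?thesis using light that True by simp
  next
    case False
    \<comment> \<open>All new pairs end in \<open>x\<close>, so the counts at the other elements are
      inherited.\<close>
    then have "{v. (v, z) \<in> ?\<sigma> \<and> z \<in> W i v} = {v. (v, z) \<in> \<sigma> \<and> z \<in> W i v}"
      by auto
    then show ?thesis using \<sigma> that False by simp
  qed
  ultimately show ?case by blast
qed

section \<open>Reachability\<close>

lemma path_between_prefix:
  assumes "path_between G x (ps @ z # qs) y"
  shows "path_between G x (ps @ [z]) z"
proof -
  have "vwalk ((ps @ [z]) @ qs) (with_proj G)"
    using assms by (auto simp: path_between_def)
  then have "vwalk (ps @ [z]) (with_proj G)"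
    by (rule vwalkI_append_l[rotated]) simp
  then show ?thesis
    using assms by (cases ps) (auto simp: path_between_def vpath_def)
qed

lemma path_between_suffix:
  assumes "path_between G x (ps @ z # qs) y"
  shows "path_between G z (z # qs) y"
proof -
  have "vwalk (z # qs) (with_proj G)"
    using assms by (intro vwalkI_append_r[of "z # qs" ps]) (auto simp: path_between_def)
  then show ?thesis
    using assms by (auto simp: path_between_def vpath_def)
qed

lemma path_between_rev:
  assumes "pair_graph G" "path_between G x P y"
  shows "path_between G y (rev P) x"
proof -
  interpret pair_graph G by fact
  have "vwalk (rev P) (with_proj G)"
    using assms(2) by (intro vwalk_rev_ex[OF pair_sym_arcs]) (auto simp: path_between_def)
  then show ?thesis
    using assms(2) by (auto simp: path_between_def vpath_def hd_rev last_rev)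
qed

lemma path_between_set: "path_between G x P y \<Longrightarrow> P \<noteq> [] \<and> set P \<subseteq> pverts G"
  by (auto simp: path_between_def vpath_def vwalk_def)

lemma path_between_singleton: "x \<in> pverts G \<Longrightarrow> path_between G x [x] x"
  by (simp add: path_between_def vpath_self)

lemma linear_order_onD:
  assumes "linear_order_on A \<sigma>"
  shows "\<sigma> \<subseteq> A \<times> A" "\<And>x. x \<in> A \<Longrightarrow> (x, x) \<in> \<sigma>" "trans \<sigma>" "antisym \<sigma>"
    "\<And>x y. x \<in> A \<Longrightarrow> y \<in> A \<Longrightarrow> (x, y) \<in> \<sigma> \<or> (y, x) \<in> \<sigma>"
  using assms by (auto simp: order_on_defs refl_on_def total_on_def) metis

lemma ex_least_linear_order_on:
  assumes lin: "linear_order_on A \<sigma>" and "finite B" "B \<noteq> {}" "B \<subseteq> A"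
  shows "\<exists>z\<in>B. \<forall>p\<in>B. (z, p) \<in> \<sigma>"
  using assms(2-4)
proof (induction rule: finite_ne_induct)
  case (singleton x)
  then show ?case using linear_order_onD(2)[OF lin] by simp
next
  case (insert x F)
  then obtain z where z: "z \<in> F" "\<forall>p\<in>F. (z, p) \<in> \<sigma>" by auto
  have x: "(x, x) \<in> \<sigma>" and "(x, z) \<in> \<sigma> \<or> (z, x) \<in> \<sigma>"
    using linear_order_onD(2,5)[OF lin] insert.prems z by blast+
  then show ?case
  proof (elim disjE)
    assume "(x, z) \<in> \<sigma>"
    then have "\<forall>p\<in>insert x F. (x, p) \<in> \<sigma>"
      using z x by (auto intro: transD[OF linear_order_onD(3)[OF lin]])
    then show ?thesis by blast
  next
    assume "(z, x) \<in> \<sigma>"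
    then show ?thesis using z by blast
  qed
qed

lemma reachable_subset:
  assumes "linear_order_on (pverts G) \<sigma>"
  shows "weakly_reachable r G \<sigma> x \<subseteq> pverts G" "strongly_reachable r G \<sigma> x \<subseteq> pverts G"
  using linear_order_onD(1)[OF assms]
  by (auto simp: weakly_reachable_def strongly_reachable_def)

lemma weakly_reachable_mono:
  "r \<le> s \<Longrightarrow> weakly_reachable r G \<sigma> x \<subseteq> weakly_reachable s G \<sigma> x"
  unfolding weakly_reachable_def by (blast intro: le_trans)

text \<open>Cutting the witnessing path at its \<open>\<tau>\<close>-least vertex \<open>z\<close>
  gives two pieces of at most \<open>r\<close> edges. Reversing the second one, by symmetry of
  \<open>G\<close>, makes both end at \<open>z\<close>.\<close>

lemma strongly_reachable_subset_weakly_reachable: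
  assumes G: "pair_graph G" and \<sigma>: "trans \<sigma>" and \<tau>: "linear_order_on (pverts G) \<tau>"
  shows "strongly_reachable r G \<sigma> x \<subseteq> weakly_reachable r G \<tau> x \<union>
    (\<Union>z\<in>weakly_reachable r G \<tau> x. {y. (y, z) \<in> \<sigma> \<and> z \<in> weakly_reachable r G \<tau> y})"
proof
  fix y assume "y \<in> strongly_reachable r G \<sigma> x"
  then obtain P where yx: "(y, x) \<in> \<sigma>" and P: "path_between G x P y"
    and len: "vwalk_length P \<le> r" and ge: "\<And>p. p \<in> set P - {y} \<Longrightarrow> (x, p) \<in> \<sigma>"
    by (auto simp: strongly_reachable_def)
  obtain z where z: "z \<in> set P" and least: "\<And>p. p \<in> set P \<Longrightarrow> (z, p) \<in> \<tau>"
    using ex_least_linear_order_on[OF \<tau>, of "set P"] path_between_set[OF P] by auto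
  have ends: "x \<in> set P" "y \<in> set P"
    using P path_between_set[OF P] by (auto simp: path_between_def)
  obtain ps qs where split: "P = ps @ z # qs"
    using split_list[OF z] by blast
  note paths = path_between_prefix[OF P[unfolded split]]
    path_between_rev[OF G path_between_suffix[OF P[unfolded split]]]
  have "z \<in> weakly_reachable r G \<tau> x"
    unfolding weakly_reachable_def
    using paths(1) least ends len split by (auto intro!: exI[of _ "ps @ [z]"])
  moreover have "z \<in> weakly_reachable r G \<tau> y"
    unfolding weakly_reachable_def
    using paths(2) least ends len split by (auto intro!: exI[of _ "rev (z # qs)"])
  \<comment> \<open>A path vertex \<open>z\<close> other than \<open>y\<close> is at least
    \<open>x\<close> in \<open>\<sigma>\<close>, and \<open>x\<close> is at least
    \<open>y\<close>.\<close>
  moreover have "(y, z) \<in> \<sigma>" if "z \<noteq> y"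
    using ge[of z] z that yx \<sigma> by (auto dest: transD)
  ultimately show "y \<in> weakly_reachable r G \<tau> x \<union>
      (\<Union>z\<in>weakly_reachable r G \<tau> x. {y. (y, z) \<in> \<sigma> \<and> z \<in> weakly_reachable r G \<tau> y})"
    by blast
qed

text \<open>Cut the path at its first vertex below \<open>x\<close>: the initial piece is one strong
  step, the remainder a shorter weak path. The condition \<open>n \<le> r\<close> ensures that each
  piece fits the fixed radius \<open>r\<close>.\<close>

lemma weakly_reachable_relpow:
  assumes lin: "linear_order_on (pverts G) \<sigma>"
  shows "y \<in> weakly_reachable n G \<sigma> x \<Longrightarrow> n \<le> r \<Longrightarrow>
    (x, y) \<in> {(a, b). b \<in> strongly_reachable r G \<sigma> a} ^^ n"
    (is "_ \<Longrightarrow> _ \<Longrightarrow> _ \<in> ?R ^^ n")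
proof (induction n arbitrary: x)
  case 0
  then obtain P where P: "path_between G x P y" "length P \<le> 1"
    by (auto simp: weakly_reachable_def)
  then have "length P = 1"
    using path_between_set[OF P(1)] by (cases P) auto
  then have "x = y"
    using P(1) by (auto simp: path_between_def length_Suc_conv)
  then show ?case by simp
next
  case (Suc n)
  then obtain P where yx: "(y, x) \<in> \<sigma>" and P: "path_between G x P y"
    and len: "vwalk_length P \<le> Suc n" and ge: "\<And>p. p \<in> set P \<Longrightarrow> (y, p) \<in> \<sigma>"
    by (auto simp: weakly_reachable_def)
  have xV: "x \<in> pverts G" and xx: "(x, x) \<in> \<sigma>"
    using yx linear_order_onD(1,2)[OF lin] by auto
  show ?case
  proof (cases "x = y")
    case True
    \<comment> \<open>The exponent is exact, so a walk that has already arrived is padded with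
      reflexive steps.\<close>
    have "(x, x) \<in> ?R"
      using xx path_between_singleton[OF xV] by (auto simp: strongly_reachable_def intro!: exI[of _ "[x]"])
    moreover have "x \<in> weakly_reachable n G \<sigma> x"
      using xx path_between_singleton[OF xV] by (auto simp: weakly_reachable_def intro!: exI[of _ "[x]"])
    then have "(x, y) \<in> ?R ^^ n"
      using Suc True by simp
    ultimately show ?thesis by (rule relpow_Suc_I2)
  next
    case False
    have "y \<in> set P"
      using P path_between_set[OF P] by (auto simp: path_between_def)
    moreover have "(x, y) \<notin> \<sigma>"
      using False yx linear_order_onD(4)[OF lin] by (auto dest: antisymD)
    \<comment> \<open>Such a \<open>z\<close> exists because \<open>y\<close> itself lies strictly
      below \<open>x\<close>.\<close>
    ultimately obtain ps z qs where split: "P = ps @ z # qs"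
      and z: "(x, z) \<notin> \<sigma>" and ps: "\<forall>p\<in>set ps. (x, p) \<in> \<sigma>"
      using split_list_first_prop[of P "\<lambda>p. (x, p) \<notin> \<sigma>"] by auto
    have "hd P = x" using P by (simp add: path_between_def)
    \<comment> \<open>Hence the first piece has at least one edge, which leaves at most
      \<open>n\<close> edges for \<open>z # qs\<close>.\<close>
    then have "ps \<noteq> []" using split z xx by auto
    have "z \<in> pverts G" using path_between_set[OF P] split by auto
    then have "(z, x) \<in> \<sigma>" using z xV linear_order_onD(5)[OF lin] by blast
    then have "(x, z) \<in> ?R"
      using path_between_prefix[of G x ps z qs y] P split ps len Suc.prems(2)
      by (auto simp: strongly_reachable_def intro!: exI[of _ "ps @ [z]"])
    moreover have "y \<in> weakly_reachable n G \<sigma> z"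
      unfolding weakly_reachable_def
      using path_between_suffix[of G x ps z qs y] P split ge len \<open>ps \<noteq> []\<close>
      by (cases ps) (auto intro!: exI[of _ "z # qs"])
    then have "(z, y) \<in> ?R ^^ n"
      using Suc by simp
    ultimately show ?thesis by (rule relpow_Suc_I2)
  qed
qed

lemma card_relpow_Image_le:
  fixes R :: "'a rel"
  assumes "\<And>a. finite (R `` {a}) \<and> card (R `` {a}) \<le> s"
  shows "finite ((R ^^ n) `` {a}) \<and> card ((R ^^ n) `` {a}) \<le> s ^ n"
proof (induction n)
  case 0
  have "(R ^^ 0) `` {a} = {a}" by auto
  then show ?case by simp
next
  case (Suc n)
  let ?A = "(R ^^ n) `` {a}"
  have eq: "(R ^^ Suc n) `` {a} = (\<Union>b\<in>?A. R `` {b})"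
    by auto
  have "card (\<Union>b\<in>?A. R `` {b}) \<le> (\<Sum>b\<in>?A. card (R `` {b}))"
    using Suc by (intro card_UN_le) simp
  also have "\<dots> \<le> card ?A * s"
    using assms sum_bounded_above[of ?A "\<lambda>b. card (R `` {b})" s] by simp
  also have "\<dots> \<le> s ^ Suc n"
    using Suc by simp
  finally show ?case
    using eq Suc assms by simp
qed

section \<open>Generalized coloring numbers\<close>

text \<open>On \<open>nat\<close> the empty supremum is 0, which covers graphs without
  vertices.\<close>

lemma SUP_nat_le:
  fixes f :: "'a \<Rightarrow> nat"
  assumes "\<And>x. x \<in> A \<Longrightarrow> f x \<le> m"
  shows "(SUP x\<in>A. f x) \<le> m"
  using assms by (cases "A = {}") (auto intro: cSUP_least)

lemma finite_orderings: "finite (pverts G) \<Longrightarrow> finite (orderings G)"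
  by (rule finite_subset[of _ "Pow (pverts G \<times> pverts G)"])
    (auto simp: orderings_def dest: linear_order_onD(1))

lemma orderings_nonempty: "orderings G \<noteq> {}"
  using well_order_on[of "pverts G"] by (auto simp: orderings_def well_order_on_def)

lemma obtain_wcol_ordering:
  assumes "finite (pverts G)"
  obtains \<sigma> where "linear_order_on (pverts G) \<sigma>" "wcol_ord r G \<sigma> = wcol r G"
  using obtains_MIN[OF finite_orderings[OF assms] orderings_nonempty, of "wcol_ord r G"]
  by (metis orderings_def wcol_def mem_Collect_eq)

lemma obtain_scol_ordering:
  assumes "finite (pverts G)"
  obtains \<sigma> where "linear_order_on (pverts G) \<sigma>" "scol_ord r G \<sigma> = scol r G"
  using obtains_MIN[OF finite_orderings[OF assms] orderings_nonempty, of "scol_ord r G"]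
  by (metis orderings_def scol_def mem_Collect_eq)

lemma card_weakly_reachable_le:
  "finite (pverts G) \<Longrightarrow> x \<in> pverts G \<Longrightarrow> card (weakly_reachable r G \<sigma> x) \<le> wcol_ord r G \<sigma>"
  unfolding wcol_ord_def by (rule cSUP_upper) auto

lemma card_strongly_reachable_le:
  "finite (pverts G) \<Longrightarrow> x \<in> pverts G \<Longrightarrow> card (strongly_reachable r G \<sigma> x) \<le> scol_ord r G \<sigma>"
  unfolding scol_ord_def by (rule cSUP_upper) auto

text \<open>Each strong step branches at most \<open>scol_ord r G \<sigma>\<close> ways, and
  \<open>r\<close> steps reach every weakly reachable vertex. Since \<open>\<sigma>\<close> is the
  same on both sides, an order optimal for \<open>scol\<close> later gives the inequality of
  minima.\<close>

lemma wcol_ord_le_scol_ord_power: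
  assumes fin: "finite (pverts G)" and lin: "linear_order_on (pverts G) \<sigma>"
  shows "wcol_ord r G \<sigma> \<le> scol_ord r G \<sigma> ^ r"
  unfolding wcol_ord_def
proof (rule SUP_nat_le)
  fix x
  let ?R = "{(a, b). b \<in> strongly_reachable r G \<sigma> a}"
  have img: "?R `` {a} = strongly_reachable r G \<sigma> a" for a by auto
  have "finite (?R `` {a}) \<and> card (?R `` {a}) \<le> scol_ord r G \<sigma>" for a
  proof (cases "a \<in> pverts G")
    case True
    then show ?thesis
      using card_strongly_reachable_le[OF fin] reachable_subset(2)[OF lin] finite_subset[OF _ fin]
      unfolding img by blast
  next
    \<comment> \<open>The branching bound is required at every element of the type; outside the
      graph the image is empty.\<close>
    case False
    then have "strongly_reachable r G \<sigma> a = {}"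
      using linear_order_onD(1)[OF lin] by (auto simp: strongly_reachable_def)
    then show ?thesis unfolding img by simp
  qed
  then have R: "finite ((?R ^^ r) `` {x}) \<and> card ((?R ^^ r) `` {x}) \<le> scol_ord r G \<sigma> ^ r"
    by (rule card_relpow_Image_le)
  have "weakly_reachable r G \<sigma> x \<subseteq> (?R ^^ r) `` {x}"
    using weakly_reachable_relpow[OF lin] by blast
  then show "card (weakly_reachable r G \<sigma> x) \<le> scol_ord r G \<sigma> ^ r"
    using R card_mono le_trans by blast
qed

lemma wcol_le_scol_power:
  assumes fin: "finite (pverts G)"
  shows "wcol r G \<le> scol r G ^ r"
proof -
  obtain \<sigma> where lin: "linear_order_on (pverts G) \<sigma>" and \<sigma>: "scol_ord r G \<sigma> = scol r G"
    using obtain_scol_ordering[OF fin] .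
  have "wcol r G \<le> wcol_ord r G \<sigma>"
    unfolding wcol_def using finite_orderings[OF fin] lin by (intro Min_le) (auto simp: orderings_def)
  then show ?thesis
    using wcol_ord_le_scol_ord_power[OF fin lin, of r] \<sigma> by simp
qed

lemma scol_ord_le:
  assumes G: "pair_graph G" and \<sigma>: "linear_order_on (pverts G) \<sigma>"
    and \<tau>: "linear_order_on (pverts G) \<tau>"
    and c: "\<And>z. z \<in> pverts G \<Longrightarrow> card {v. (v, z) \<in> \<sigma> \<and> z \<in> weakly_reachable r G \<tau> v} \<le> c"
  shows "scol_ord r G \<sigma> \<le> wcol_ord r G \<tau> + wcol_ord r G \<tau> * c"
  unfolding scol_ord_def
proof (rule SUP_nat_le)
  fix x assume x: "x \<in> pverts G"
  interpret pair_graph G by fact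
  let ?W = "weakly_reachable r G \<tau> x"
  let ?D = "\<lambda>z. {y. (y, z) \<in> \<sigma> \<and> z \<in> weakly_reachable r G \<tau> y}"
  have W: "?W \<subseteq> pverts G" by (rule reachable_subset[OF \<tau>])
  then have finW: "finite ?W" using finite_subset pair_finite_verts by blast
  have "?D z \<subseteq> pverts G" for z
    using linear_order_onD(1)[OF \<sigma>] by auto
  then have finD: "finite (?D z)" for z using finite_subset pair_finite_verts by blast
  have cardW: "card ?W \<le> wcol_ord r G \<tau>"
    by (rule card_weakly_reachable_le[OF pair_finite_verts x])
  have "card (strongly_reachable r G \<sigma> x) \<le> card (?W \<union> (\<Union>z\<in>?W. ?D z))"
    using strongly_reachable_subset_weakly_reachable[OF G linear_order_onD(3)[OF \<sigma>] \<tau>] finW finD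
    by (intro card_mono) auto
  also have "\<dots> \<le> card ?W + card (\<Union>z\<in>?W. ?D z)"
    by (rule card_Un_le)
  also have "card (\<Union>z\<in>?W. ?D z) \<le> (\<Sum>z\<in>?W. card (?D z))"
    by (rule card_UN_le[OF finW])
  also have "(\<Sum>z\<in>?W. card (?D z)) \<le> card ?W * c"
    using c W sum_bounded_above[of ?W "\<lambda>z. card (?D z)" c] by auto
  also have "card ?W + card ?W * c \<le> wcol_ord r G \<tau> + wcol_ord r G \<tau> * c"
    using cardW by (intro add_mono mult_right_mono) auto
  finally show "card (strongly_reachable r G \<sigma> x) \<le> wcol_ord r G \<tau> + wcol_ord r G \<tau> * c"
    by simp
qed

lemma wcol_ord_mono:
  assumes fin: "finite (pverts G)" and lin: "linear_order_on (pverts G) \<tau>" and "r \<le> s"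
  shows "wcol_ord r G \<tau> \<le> wcol_ord s G \<tau>"
  unfolding wcol_ord_def[of r]
proof (rule SUP_nat_le)
  fix x assume x: "x \<in> pverts G"
  have "finite (weakly_reachable s G \<tau> x)"
    by (rule finite_subset[OF reachable_subset(1)[OF lin] fin])
  then have "card (weakly_reachable r G \<tau> x) \<le> card (weakly_reachable s G \<tau> x)"
    by (rule card_mono) (rule weakly_reachable_mono[OF \<open>r \<le> s\<close>])
  then show "card (weakly_reachable r G \<tau> x) \<le> wcol_ord s G \<tau>"
    using card_weakly_reachable_le[OF fin x, of s \<tau>] by simp
qed

theorem theorem1p7:
  fixes V :: "'a set"
    and k :: nat
    and G :: "nat \<Rightarrow> 'a pair_pre_digraph"
    and r :: "nat \<Rightarrow> nat"
  assumes "\<And>i. i \<in> {1..k} \<Longrightarrow> pair_graph (G i)"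
    and "\<And>i. i \<in> {1..k} \<Longrightarrow> pverts (G i) = V"
    and "\<And>i. i \<in> {1..k} \<Longrightarrow> r i \<ge> 1"
  shows "\<exists>\<sigma>. linear_order_on V \<sigma> \<and>
    (\<forall>i\<in>{1..k}.
      scol_ord (r i) (G i) \<sigma> \<le> (k + 1) * (wcol (2 * r i) (G i))\<^sup>2 \<and>
      (k + 1) * (wcol (2 * r i) (G i))\<^sup>2 \<le> (k + 1) * scol (2 * r i) (G i) ^ (4 * r i))"
proof (cases "k = 0")
  \<comment> \<open>With no graphs, any linear order on \<open>V\<close> will do, and
    \<open>V\<close> may be infinite; the well-ordering theorem supplies one.\<close>
  case True
  then show ?thesis
    using well_order_on[of V] by (auto simp: well_order_on_def)
next
  case False
  have fin: "finite (pverts (G i))" if "i \<in> {1..k}" for i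
    using assms(1)[OF that] by (simp add: pair_fin_digraph.pair_finite_verts pair_graph_def pair_digraph_def)
  then have finV: "finite V" using False assms(2)[of 1] by force
  define w where "w i = wcol (2 * r i) (G i)" for i
  have "\<exists>\<tau>. linear_order_on V \<tau> \<and> wcol_ord (2 * r i) (G i) \<tau> = w i" if "i \<in> {1..k}" for i
    using obtain_wcol_ordering[OF fin[OF that]] assms(2)[OF that] unfolding w_def by metis
  then obtain \<tau> where \<tau>: "\<And>i. i \<in> {1..k} \<Longrightarrow> linear_order_on V (\<tau> i)"
    and opt: "\<And>i. i \<in> {1..k} \<Longrightarrow> wcol_ord (2 * r i) (G i) (\<tau> i) = w i"
    by metis
  \<comment> \<open>\<open>\<tau> i\<close> is optimal for radius \<open>2 * r i\<close>, while the
    greedy order is built from weak reachability at radius \<open>r i\<close>; monotonicity in the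
    radius transfers the bound.\<close>
  have ord_le: "wcol_ord (r i) (G i) (\<tau> i) \<le> w i" if "i \<in> {1..k}" for i
    using wcol_ord_mono[OF fin[OF that], of "\<tau> i" "r i" "2 * r i"] \<tau> opt assms(2) that by simp
  let ?W = "\<lambda>i v. weakly_reachable (r i) (G i) (\<tau> i) v"
  have "finite (?W i v) \<and> card (?W i v) \<le> w i" if i: "i \<in> {1..k}" and v: "v \<in> V" for i v
    using reachable_subset(1)[of "G i" "\<tau> i" "r i" v] finite_subset[OF _ finV] \<tau>[OF i] assms(2)[OF i]
      card_weakly_reachable_le[OF fin[OF i], of v "r i" "\<tau> i"] ord_le[OF i] v
    by (auto intro: le_trans)
  then obtain \<sigma> where \<sigma>: "linear_order_on V \<sigma>"
    and few: "\<And>z i. z \<in> V \<Longrightarrow> i \<in> {1..k} \<Longrightarrow> card {v. (v, z) \<in> \<sigma> \<and> z \<in> ?W i v} \<le> k * w i"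
    using ex_linear_order_small_preimages[OF finV, of "{1..k}" ?W w] by auto
  have "scol_ord (r i) (G i) \<sigma> \<le> (k + 1) * (w i)\<^sup>2 \<and>
      (k + 1) * (w i)\<^sup>2 \<le> (k + 1) * scol (2 * r i) (G i) ^ (4 * r i)"
    if i: "i \<in> {1..k}" for i
  proof
    let ?u = "wcol_ord (r i) (G i) (\<tau> i)"
    have "scol_ord (r i) (G i) \<sigma> \<le> ?u + ?u * (k * w i)"
      using scol_ord_le[OF assms(1)[OF i], of \<sigma> "\<tau> i" "r i" "k * w i"] \<sigma> \<tau>[OF i] few i
      by (simp add: assms(2)[OF i])
    also have "\<dots> \<le> w i + w i * (k * w i)"
      using ord_le[OF i] by (intro add_mono mult_right_mono) auto
    \<comment> \<open>The linear term is absorbed by \<open>n \<le> n * n\<close>, valid for every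
      natural number; this turns the factor \<open>k\<close> into \<open>k + 1\<close>.\<close>
    also have "\<dots> \<le> w i * w i + w i * (k * w i)"
      by (simp add: le_square)
    also have "\<dots> = (k + 1) * (w i)\<^sup>2"
      by (simp add: power2_eq_square algebra_simps)
    finally show "scol_ord (r i) (G i) \<sigma> \<le> (k + 1) * (w i)\<^sup>2" .
    have "(w i)\<^sup>2 \<le> (scol (2 * r i) (G i) ^ (2 * r i))\<^sup>2"
      unfolding w_def by (intro power_mono wcol_le_scol_power fin[OF i]) simp
    also have "\<dots> = scol (2 * r i) (G i) ^ (4 * r i)"
      by (simp add: power_mult[symmetric] mult.commute)
    finally show "(k + 1) * (w i)\<^sup>2 \<le> (k + 1) * scol (2 * r i) (G i) ^ (4 * r i)"
      by (rule mult_left_mono) simp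
  qed
  then show ?thesis
    using \<sigma> unfolding w_def by blast
qed

end
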